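(* Let $N\geq 3$ be an integer and let $h:[0,\infty)\to[0,\infty)$ and $g:(0,\infty)\to\mathbb{R}$ be functions satisfying the following. (h1) $h$ is continuous and nondecreasing, $h(0)=0$, and $h(s)>0$ for all $s\in(0,\infty)$. (g1) $g$ is continuous and there exists $s_0\in(0,\infty)$ such that $g$ is nondecreasing on $(s_0,\infty)$, $\lim_{s\to 0+}g(s)=g(s_0)=0$, $g(s)<0$ for all $s\in(0,s_0)$, and $g(s)>0$ for all $s\in(s_0,\infty)$. (O) For this $s_0$ and for every $c>s_0$, $\displaystyle \lim_{t\to\infty}\int_{c}^{t}\frac{1}{h(\tau)+g(\tau)}\,d\tau=\infty$. Let $a,b$ be nonnegative continuous spherically symmetric functions on $\mathbb{R}^N$, written $a(r),b(r)$ with $r=|x|$. Let $u_0\geq s_0$ be a real number, and define functions $u_n:[0,\infty)\to\mathbb{R}$ by letting the initial iterate (index $n=0$) be the constant function equal to $u_0$ and, for $n\geq 1$ and $r\geq 0$, $$u_n(r)=u_0+\int_0^r t^{1-N}\int_0^t s^{N-1}\bigl(a(s)h(u_{n-1}(s))+b(s)g(u_{n-1}(s))\bigr)\,ds\,dt .$$ Then the sequence $(u_n)$ converges locally uniformly on $[0,\infty)$ to a positive spherically symmetric function $u\in C^2[0,\infty)$, and $u$ (i.e. $x\mapsto u(|x|)$) is a solution of $$\Delta u=a(|x|)h(u)+b(|x|)g(u)\quad\text{for }x\in\mathbb{R}^N$$ with $u(0)=u_0$. In addition, for any $c_0>0$: (A1) there exists $\overline{C}_1>u_0$ such that $u_0\leq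 u(r)\leq\overline{C}_1$ for all $r\in[0,c_0]$; (A2) there exists $\overline{C}_2>0$ such that $0\leq u'(r)\leq\overline{C}_2(r+1)$ for all $r\in[0,c_0]$. Moreover, set $$m(s)=\begin{cases}a(s)h(u_0) & \text{if } g(u_0)=0,\\ (a(s)+b(s))\min\{h(u_0),g(u_0)\} & \text{if } g(u_0)\neq 0,\end{cases}$$ $$\underline{P}(r)=\int_0^r t^{1-N}\int_0^t s^{N-1}m(s)\,ds\,dt,\qquad \overline{P}(r)=\int_0^r t^{1-N}\int_0^t s^{N-1}(a(s)+b(s))\,ds\,dt,$$ and $\underline{P}(\infty)=\lim_{r\to\infty}\underline{P}(r)$, $\overline{P}(\infty)=\lim_{r\to\infty}\overline{P}(r)$. If $\underline{P}(\infty)=\infty$, then $\lim_{r\to\infty}u(r)=\infty$. If $\overline{P}(\infty)<\infty$, then $\lim_{r\to\infty}u(r)<\infty$.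
   Context: $|x|$ denotes the Euclidean norm on $\mathbb{R}^N$. A function on $\mathbb{R}^N$ is spherically symmetric if it depends only on $r=|x|$; such a function is identified with the corresponding function of $r\in[0,\infty)$, and $u'$ denotes the derivative with respect to $r$. *)

theory Defs
  imports "HOL-Analysis.Analysis"
begin

definition partial_deriv :: "'a::euclidean_space \<Rightarrow> ('a \<Rightarrow> real) \<Rightarrow> 'a \<Rightarrow> real" where
  "partial_deriv i f x = deriv (\<lambda>t. f (x + t *\<^sub>R i)) 0"

definition C1_space :: "('a::euclidean_space \<Rightarrow> real) \<Rightarrow> bool" where
  "C1_space f \<longleftrightarrow>
     (\<forall>x. f differentiable (at x)) \<and> (\<forall>i\<in>Basis. continuous_on UNIV (partial_deriv i f))"

definition C2_space :: "('a::euclidean_space \<Rightarrow> real) \<Rightarrow> bool" where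
  "C2_space f \<longleftrightarrow> C1_space f \<and> (\<forall>i\<in>Basis. C1_space (partial_deriv i f))"

definition laplacian :: "('a::euclidean_space \<Rightarrow> real) \<Rightarrow> 'a \<Rightarrow> real" where
  "laplacian f x = (\<Sum>i\<in>Basis. partial_deriv i (partial_deriv i f) x)"

text \<open>Functions on $[0,\infty)$ are total functions whose values at negative arguments are
  irrelevant; their derivatives are taken within the half-line, so at $0$ they are one-sided.\<close>

definition rderiv :: "(real \<Rightarrow> real) \<Rightarrow> real \<Rightarrow> real" where
  "rderiv u r = vector_derivative u (at r within {0..})"

definition C2_halfline :: "(real \<Rightarrow> real) \<Rightarrow> bool" where
  "C2_halfline u \<longleftrightarrow>
     u differentiable_on {0..} \<and> rderiv u differentiable_on {0..} \<and>
     continuous_on {0..} (rderiv (rderiv u))"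

definition locally_uniform_limit ::
    "real set \<Rightarrow> (nat \<Rightarrow> real \<Rightarrow> real) \<Rightarrow> (real \<Rightarrow> real) \<Rightarrow> bool" where
  "locally_uniform_limit S f l \<longleftrightarrow>
     (\<forall>x\<in>S. \<exists>d>0. uniform_limit (ball x d \<inter> S) f l sequentially)"

text \<open>The value of the outer integrand at $t = 0$, where \<open>0 powi (1 - int N) = 0\<close> for $N > 1$,
  does not affect the integral.\<close>

definition radial_integral :: "nat \<Rightarrow> (real \<Rightarrow> real) \<Rightarrow> real \<Rightarrow> real" where
  "radial_integral N f r =
     integral {0..r} (\<lambda>t. t powi (1 - int N) * integral {0..t} (\<lambda>s. s ^ (N - 1) * f s))"

primrec radial_iterate ::
    "nat \<Rightarrow> (real \<Rightarrow> real) \<Rightarrow> (real \<Rightarrow> real) \<Rightarrow> (real \<Rightarrow> real) \<Rightarrow> (real \<Rightarrow> real) \<Rightarrow> real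
       \<Rightarrow> nat \<Rightarrow> real \<Rightarrow> real" where
  "radial_iterate N a b h g u0 0 = (\<lambda>r. u0)"
| "radial_iterate N a b h g u0 (Suc n) =
     (\<lambda>r. u0 + radial_integral N
        (\<lambda>s. a s * h (radial_iterate N a b h g u0 n s)
            + b s * g (radial_iterate N a b h g u0 n s)) r)"

end

theory Submission
  imports Defs
begin

text \<open>
  Put \<open>M f r = \<integral>\<^sub>0\<^sup>1 s\<^sup>N\<^sup>-\<^sup>1 f (r s) ds\<close>, which is continuous up to \<open>r = 0\<close>. The radial integral \<open>P f\<close>
  satisfies \<open>(P f)' = r M f\<close> and \<open>r (M f)' = f - N M f\<close>, so \<open>x \<mapsto> P f \<bar>x\<bar>\<close> has gradient \<open>M f \<bar>x\<bar> x\<close>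
  and Laplacian \<open>f \<bar>x\<bar>\<close>, also at the origin.

  The iterates increase with \<open>n\<close> and with \<open>r\<close>, hence \<open>u\<^sub>n' \<le> (h + g)(u\<^sub>n) P(a + b)'\<close>. Dividing and
  integrating, \<open>\<integral> d\<tau> / (h + g)\<close> from \<open>u\<^sub>0\<close> to \<open>u\<^sub>n r\<close> is at most \<open>P (a + b) r\<close>, and the Osgood condition
  bounds \<open>u\<^sub>n\<close> on \<open>[0, c]\<close> independently of \<open>n\<close>. The iterates are then uniformly Lipschitz there, so
  their pointwise limit is continuous and the convergence is uniform by Dini's theorem. The limit
  satisfies the same Osgood estimate, which yields its boundedness when \<open>P (a + b)\<close> converges.
\<close>

subsection \<open>Radial integrals\<close>

text \<open>Integrating over the fixed interval from 0 to 1 avoids a division by \<open>r\<close>.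
  For \<open>N \<ge> 1\<close> and continuous \<open>f\<close>, \<open>N\<close> times this is the
  average of \<open>f\<close> at \<open>norm x\<close> over the ball of radius \<open>r\<close> in
  dimension \<open>N\<close>.\<close>

definition radial_mean :: "nat \<Rightarrow> (real \<Rightarrow> real) \<Rightarrow> real \<Rightarrow> real" where
  "radial_mean N f r = integral {0..1} (\<lambda>s. s ^ (N - 1) * f (r * s))"

lemma radial_mean_integrable:
  fixes f :: "real \<Rightarrow> real"
  assumes "continuous_on {0..} f" "r \<ge> 0"
  shows "(\<lambda>s. s ^ (N - 1) * f (r * s)) integrable_on {0..1}"
  using assms by (intro integrable_continuous_real continuous_intros continuous_on_compose2[OF assms(1)]) auto

lemma continuous_on_radial_mean:
  assumes "continuous_on {0..} f"
  shows "continuous_on {0..} (radial_mean N f)"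
proof -
  have "continuous_on ({0..} \<times> cbox 0 1) (\<lambda>(r, s). s ^ (N - 1) * f (r * s))"
    unfolding split_def
    by (intro continuous_intros continuous_on_compose2[OF assms]) auto
  from integral_continuous_on_param[OF this] show ?thesis
    by (simp add: radial_mean_def[abs_def])
qed

lemma integral_unit_power: "N \<ge> 1 \<Longrightarrow> integral {0..1} (\<lambda>s::real. s ^ (N - 1)) = 1 / real N"
proof -
  assume N: "N \<ge> 1"
  have "((\<lambda>s::real. s ^ (N - 1)) has_integral 1 ^ N / real N - 0 ^ N / real N) {0..1}"
  proof (rule fundamental_theorem_of_calculus)
    fix x :: real
    show "((\<lambda>s. s ^ N / real N) has_vector_derivative x ^ (N - 1)) (at x within {0..1})"
      using N unfolding has_real_derivative_iff_has_vector_derivative[symmetric]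
      by (auto intro!: derivative_eq_intros)
  qed auto
  with N show ?thesis by (simp add: integral_unique power_0_left)
qed

lemma radial_mean_mono:
  assumes "continuous_on {0..} f" "continuous_on {0..} k" "r \<ge> 0"
    and "\<And>s. 0 \<le> s \<Longrightarrow> s \<le> r \<Longrightarrow> f s \<le> k s"
  shows "radial_mean N f r \<le> radial_mean N k r"
  unfolding radial_mean_def using assms
  by (intro integral_le radial_mean_integrable mult_left_mono) (auto simp: mult_left_le)

text \<open>If the integrand is not integrable, its integral is 0 by convention, so the bound holds
  in that case too.\<close>

lemma radial_mean_nonneg:
  assumes "r \<ge> 0" "\<And>s. 0 \<le> s \<Longrightarrow> s \<le> r \<Longrightarrow> 0 \<le> f s"
  shows "0 \<le> radial_mean N f r"
  unfolding radial_mean_def using assms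
  by (cases "(\<lambda>s. s ^ (N - 1) * f (r * s)) integrable_on {0..1}")
     (auto intro!: integral_nonneg simp: mult_left_le not_integrable_integral)

lemma radial_mean_diff:
  assumes "continuous_on {0..} f" "continuous_on {0..} k" "r \<ge> 0"
  shows "radial_mean N (\<lambda>s. f s - k s) r = radial_mean N f r - radial_mean N k r"
  using radial_mean_integrable[OF assms(1,3), of N] radial_mean_integrable[OF assms(2,3), of N]
  by (simp add: radial_mean_def integral_diff[symmetric] right_diff_distrib)

lemma radial_mean_cmult: "radial_mean N (\<lambda>s. c * f s) r = c * radial_mean N f r"
  unfolding radial_mean_def by (subst integral_mult_right[symmetric]) (simp add: mult.left_commute)

lemma radial_mean_const: "N \<ge> 1 \<Longrightarrow> radial_mean N (\<lambda>s. c) r = c / real N"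
  using radial_mean_cmult[of N c "\<lambda>_. 1" r] integral_unit_power[of N]
  by (simp add: radial_mean_def)

lemma radial_mean_0: "N \<ge> 1 \<Longrightarrow> radial_mean N f 0 = f 0 / real N"
  using radial_mean_const[of N "f 0" 0] by (simp add: radial_mean_def)

lemma integral_eq_radial_mean:
  assumes "N \<ge> 1" "r \<ge> 0"
  shows "integral {0..r} (\<lambda>s. s ^ (N - 1) * f s) = r ^ N * radial_mean N f r"
proof (cases "r = 0")
  case False
  with assms have r: "r > 0" by simp
  have im: "(\<lambda>x. x / r) ` {0..r} = {0..1}"
    using r by (auto simp: image_iff divide_simps intro!: bexI[of _ "r * x" for x])
  have "integral {0..1} (\<lambda>s. (r * s) ^ (N - 1) * f (r * s))
          = (1 / r) * integral {0..r} (\<lambda>s. s ^ (N - 1) * f s)"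
    using integral_stretch_real[of r 0 r "\<lambda>s. s ^ (N - 1) * f s"] r im by simp
  moreover have "integral {0..1} (\<lambda>s. (r * s) ^ (N - 1) * f (r * s)) = r ^ (N - 1) * radial_mean N f r"
    unfolding radial_mean_def
    by (subst integral_mult_right[symmetric]) (simp add: power_mult_distrib mult_ac)
  ultimately show ?thesis
    using r assms(1) by (simp add: field_simps power_eq_if[of r N])
qed (use assms in auto)

text \<open>The inner integral contributes \<open>t ^ N\<close>, which combines with the outer
  weight to the factor \<open>t\<close>. At \<open>t = 0\<close> both integrands vanish.\<close>

lemma radial_integral_eq:
  assumes "N \<ge> 2"
  shows "radial_integral N f r = integral {0..r} (\<lambda>t. t * radial_mean N f t)"
  unfolding radial_integral_def
proof (intro Henstock_Kurzweil_Integration.integral_cong)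
  fix t assume t: "t \<in> {0..r}"
  show "t powi (1 - int N) * integral {0..t} (\<lambda>s. s ^ (N - 1) * f s) = t * radial_mean N f t"
  proof (cases "t = 0")
    case False
    then have "t powi (1 - int N) = t / t ^ N"
      using power_int_diff[of t 1 "int N"] by simp
    with False t assms show ?thesis
      by (subst integral_eq_radial_mean) auto
  qed (use assms in auto)
qed

text \<open>Limits at \<open>r\<close> only see a neighbourhood of \<open>r\<close>, so facts about
  compact intervals, such as the fundamental theorem of calculus, carry over to the
  half-line.\<close>

lemma at_within_Ici_restrict:
  fixes r :: real
  assumes "r \<ge> c"
  shows "at r within {c..} = at r within {c..r + 1}"
  by (rule at_within_nhd[of _ "{..<r + 1}"]) auto

lemma integral_Ici_has_real_derivative:
  fixes c :: real
  assumes "continuous_on {c..} f" "r \<ge> c"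
  shows "((\<lambda>x. integral {c..x} f) has_real_derivative f r) (at r within {c..})"
  unfolding at_within_Ici_restrict[OF assms(2)]
  using assms by (intro integral_has_real_derivative continuous_on_subset[OF assms(1)]) auto

lemma radial_integral_has_derivative:
  assumes "N \<ge> 2" "continuous_on {0..} f" "r \<ge> 0"
  shows "(radial_integral N f has_real_derivative r * radial_mean N f r) (at r within {0..})"
proof -
  have "((\<lambda>x. integral {0..x} (\<lambda>t. t * radial_mean N f t)) has_real_derivative r * radial_mean N f r)
      (at r within {0..})"
    using assms by (intro integral_Ici_has_real_derivative continuous_intros continuous_on_radial_mean)
  then show ?thesis
    using radial_integral_eq[OF assms(1), of f] by presburger
qed

text \<open>For \<open>r > 0\<close> the mean is the integral \<open>?G r\<close> divided by
  \<open>r ^ N\<close>, and the quotient rule applies. At 0 the mean of a merely continuous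
  \<open>f\<close> can fail to be differentiable, as for the square root.\<close>

lemma radial_mean_has_derivative:
  assumes "N \<ge> 1" "continuous_on {0..} f" "r > 0"
  shows "(radial_mean N f has_real_derivative (f r - real N * radial_mean N f r) / r) (at r)"
proof -
  let ?G = "\<lambda>x. integral {0..x} (\<lambda>s. s ^ (N - 1) * f s)"
  have at: "at r within {0..} = at r"
    using assms by (intro at_within_interior) auto
  have "continuous_on {0..} (\<lambda>s. s ^ (N - 1) * f s)"
    by (intro continuous_intros assms)
  from integral_Ici_has_real_derivative[OF this, of r]
  have "(?G has_real_derivative r ^ (N - 1) * f r) (at r)"
    using assms by (simp add: at)
  then have "((\<lambda>x. ?G x / x ^ N) has_real_derivative
      ((r ^ (N - 1) * f r) * r ^ N - ?G r * (real N * r ^ (N - 1))) / (r ^ N * r ^ N)) (at r)"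
    using assms by (auto intro!: derivative_eq_intros)
  moreover have "((r ^ (N - 1) * f r) * r ^ N - ?G r * (real N * r ^ (N - 1))) / (r ^ N * r ^ N)
      = (f r - real N * radial_mean N f r) / r"
    using assms
    by (subst integral_eq_radial_mean) (auto simp: power_eq_if[of r N] field_simps)
  ultimately have *: "((\<lambda>x. ?G x / x ^ N) has_real_derivative (f r - real N * radial_mean N f r) / r) (at r)"
    by simp
  show ?thesis
    by (rule has_field_derivative_transform_within_open[OF *, of "{0<..}"])
       (use assms in \<open>auto simp: integral_eq_radial_mean[simplified]\<close>)
qed

text \<open>The factor \<open>r\<close> restores differentiability at 0: the difference quotient
  there is the mean itself, whose limit \<open>f 0 / N\<close> is the value of the stated
  formula.\<close>

lemma times_radial_mean_has_derivative:
  assumes "N \<ge> 1" "continuous_on {0..} f" "r \<ge> 0"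
  shows "((\<lambda>r. r * radial_mean N f r) has_real_derivative
           f r - (real N - 1) * radial_mean N f r) (at r within {0..})"
proof (cases "r = 0")
  case True
  have "(radial_mean N f \<longlongrightarrow> radial_mean N f 0) (at 0 within {0..})"
    using continuous_on_radial_mean[OF assms(2), of N] by (auto simp: continuous_on_def)
  then have "((\<lambda>y. (y * radial_mean N f y) / y) \<longlongrightarrow> radial_mean N f 0) (at 0 within {0..})"
    by (rule Lim_transform_eventually) (auto simp: eventually_at_filter)
  moreover have "radial_mean N f 0 = f 0 - (real N - 1) * radial_mean N f 0"
    using assms by (simp add: radial_mean_0 field_simps)
  ultimately show ?thesis using True by (simp add: has_field_derivative_iff)
next
  case False
  with assms have "((\<lambda>r. r * radial_mean N f r) has_real_derivative
           f r - (real N - 1) * radial_mean N f r) (at r)"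
    by (auto intro!: derivative_eq_intros radial_mean_has_derivative simp: field_simps)
  then show ?thesis by (rule has_field_derivative_at_within)
qed

section \<open>Regularity on the half-line\<close>

lemma rderiv_eqI:
  assumes "(u has_real_derivative d) (at r within {0..})" "r \<ge> 0"
  shows "rderiv u r = d"
proof -
  \<comment> \<open>The derivative within the half-line is unique because \<open>r\<close>, even
    when it is 0, is a limit point of it.\<close>
  have "at r within {0..} \<noteq> bot"
    using assms(2) by (simp add: at_within_Ici_restrict trivial_limit_within islimpt_Icc)
  then show ?thesis
    unfolding rderiv_def using assms(1)
    by (intro vector_derivative_within) (auto simp: has_real_derivative_iff_has_vector_derivative)
qed

lemma rderiv_radial_integral:
  assumes "N \<ge> 2" "continuous_on {0..} f" "r \<ge> 0"
  shows "rderiv (\<lambda>r. c + radial_integral N f r) r = r * radial_mean N f r"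
  using assms by (intro rderiv_eqI) (auto intro!: derivative_eq_intros radial_integral_has_derivative)

text \<open>The second derivative is \<open>f r - (N - 1) * radial_mean N f r\<close>, and it
  inherits continuity at 0 from \<open>f\<close> and its mean.\<close>

lemma C2_halfline_radial_integral:
  assumes "N \<ge> 2" "continuous_on {0..} f"
  shows "C2_halfline (\<lambda>r. c + radial_integral N f r)"
proof -
  let ?u = "\<lambda>r. c + radial_integral N f r"
  have d1: "(?u has_real_derivative r * radial_mean N f r) (at r within {0..})" if "r \<ge> 0" for r
    using that assms by (auto intro!: derivative_eq_intros radial_integral_has_derivative)
  have d2: "(rderiv ?u has_real_derivative f r - (real N - 1) * radial_mean N f r) (at r within {0..})"
    if "r \<ge> 0" for r
    by (rule has_field_derivative_transform_within[OF times_radial_mean_has_derivative, of _ _ _ 1])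
       (use that assms in \<open>auto simp: rderiv_radial_integral\<close>)
  have "continuous_on {0..} (\<lambda>r. f r - (real N - 1) * radial_mean N f r)"
    using assms by (intro continuous_intros continuous_on_radial_mean)
  then have "continuous_on {0..} (rderiv (rderiv ?u))"
    by (rule continuous_on_eq) (use rderiv_eqI[OF d2] in auto)
  with d1 d2 show ?thesis
    unfolding C2_halfline_def differentiable_on_def
    by (meson atLeast_iff real_differentiable_def)
qed

text \<open>The one-sided derivative at \<open>c\<close> enters only through continuity. The sign of
  the derivative is used at interior points, where it is two-sided.\<close>

lemma mono_on_if_derivative_nonneg:
  fixes f :: "real \<Rightarrow> real"
  assumes d: "\<And>r. r \<ge> c \<Longrightarrow> (f has_real_derivative f' r) (at r within {c..})"
    and nonneg: "\<And>r. r \<ge> c \<Longrightarrow> f' r \<ge> 0"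
  shows "mono_on {c..} f"
proof (rule mono_onI)
  fix x y :: real assume xy: "x \<in> {c..}" "y \<in> {c..}" "x \<le> y"
  have "continuous_on {c..} f"
    using d by (intro DERIV_continuous_on) auto
  then show "f x \<le> f y"
  proof (intro DERIV_nonneg_imp_increasing_open[OF xy(3)])
    fix z assume z: "x < z" "z < y"
    then have "at z within {c..} = at z"
      using xy by (intro at_within_interior) auto
    with d[of z] nonneg[of z] z xy show "\<exists>d. (f has_real_derivative d) (at z) \<and> 0 \<le> d"
      by (metis atLeast_iff less_imp_le order_trans)
  qed (use xy in \<open>auto intro: continuous_on_subset\<close>)
qed

section \<open>Monotonicity and comparison of radial integrals\<close>

lemma mono_on_radial_integral:
  assumes "N \<ge> 2" "continuous_on {0..} f" "\<And>s. s \<ge> 0 \<Longrightarrow> f s \<ge> 0"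
  shows "mono_on {0..} (radial_integral N f)"
  using assms
  by (intro mono_on_if_derivative_nonneg[OF radial_integral_has_derivative]
      mult_nonneg_nonneg radial_mean_nonneg) auto

lemma radial_integral_mono:
  assumes "N \<ge> 2" "continuous_on {0..} f" "continuous_on {0..} k"
    and "\<And>s. 0 \<le> s \<Longrightarrow> s \<le> r \<Longrightarrow> f s \<le> k s"
  shows "radial_integral N f r \<le> radial_integral N k r"
  unfolding radial_integral_eq[OF assms(1)]
proof (intro integral_le)
  show "(\<lambda>t. t * radial_mean N f t) integrable_on {0..r}"
       "(\<lambda>t. t * radial_mean N k t) integrable_on {0..r}"
    using assms(2,3)
    by (auto intro!: integrable_continuous_real continuous_intros
          intro: continuous_on_subset[OF continuous_on_radial_mean])
qed (use assms in \<open>auto intro!: mult_left_mono radial_mean_mono\<close>)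

lemma radial_integral_0 [simp]: "radial_integral N f 0 = 0"
  by (simp add: radial_integral_def)

lemma radial_integral_nonneg:
  assumes "N \<ge> 2" "continuous_on {0..} f" "\<And>s. s \<ge> 0 \<Longrightarrow> f s \<ge> 0" "r \<ge> 0"
  shows "radial_integral N f r \<ge> 0"
  using mono_onD[OF mono_on_radial_integral[OF assms(1-3)], of 0 r] assms(4) by simp

lemma continuous_on_radial_integral:
  assumes "N \<ge> 2" "continuous_on {0..} f"
  shows "continuous_on {0..} (radial_integral N f)"
  using radial_integral_has_derivative[OF assms] by (intro DERIV_continuous_on) auto

text \<open>The means differ by at most \<open>e / N \<le> e\<close>, so the integrands differ by at
  most \<open>e * r\<close> on an interval of length \<open>r\<close>. This later allows the limit
  to pass under the integral.\<close>

lemma radial_integral_dist_le: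
  assumes N: "N \<ge> 2" and cont: "continuous_on {0..} f" "continuous_on {0..} k"
    and r: "0 \<le> r" and le: "\<And>s. 0 \<le> s \<Longrightarrow> s \<le> r \<Longrightarrow> \<bar>f s - k s\<bar> \<le> e"
  shows "\<bar>radial_integral N f r - radial_integral N k r\<bar> \<le> e * r\<^sup>2"
proof -
  have int: "(\<lambda>t. t * radial_mean N f t) integrable_on {0..r}"
    if "continuous_on {0..} f" for f
    using that
    by (auto intro!: integrable_continuous_real continuous_intros
          intro: continuous_on_subset[OF continuous_on_radial_mean])
  have e: "e \<ge> 0" using le[of 0] r by linarith
  have bound: "\<bar>t * radial_mean N f t - t * radial_mean N k t\<bar> \<le> e * r" if t: "t \<in> {0..r}" for t
  proof -
    have "radial_mean N (\<lambda>s. f s - k s) t \<le> radial_mean N (\<lambda>s. e) t"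
         "radial_mean N (\<lambda>s. - e) t \<le> radial_mean N (\<lambda>s. f s - k s) t"
      using t le by (intro radial_mean_mono continuous_intros cont; force)+
    moreover have "e / real N \<le> e"
      using N e mult_left_mono[of 1 "real N" e] by (simp add: divide_le_eq)
    ultimately have "\<bar>radial_mean N f t - radial_mean N k t\<bar> \<le> e"
      using N t by (simp add: radial_mean_diff cont radial_mean_const)
    then have "\<bar>t\<bar> * \<bar>radial_mean N f t - radial_mean N k t\<bar> \<le> r * e"
      using t by (intro mult_mono) auto
    then show ?thesis by (simp add: abs_mult[symmetric] algebra_simps)
  qed
  have "norm (integral {0..r} (\<lambda>t. t * radial_mean N f t - t * radial_mean N k t)) \<le> e * r * (r - 0)"
    using bound r by (intro integral_bound continuous_intros
        continuous_on_subset[OF continuous_on_radial_mean] cont) auto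
  then show ?thesis
    using N int cont by (simp add: radial_integral_eq integral_diff power2_eq_square mult.assoc)
qed

subsection \<open>Radial functions on Euclidean space\<close>

lemma partial_deriv_eqI:
  assumes "(f has_derivative D) (at x)"
  shows "partial_deriv i f x = D i"
proof -
  interpret bounded_linear D using assms by (rule has_derivative_bounded_linear)
  have "((\<lambda>t. x + t *\<^sub>R i) has_derivative (\<lambda>t. t *\<^sub>R i)) (at 0)"
    by (auto intro!: derivative_eq_intros)
  moreover have "(f has_derivative D) (at (x + 0 *\<^sub>R i))"
    using assms by simp
  ultimately have "((\<lambda>t. f (x + t *\<^sub>R i)) has_derivative (\<lambda>t. D (t *\<^sub>R i))) (at 0)"
    by (rule has_derivative_compose)
  then have "((\<lambda>t. f (x + t *\<^sub>R i)) has_real_derivative D i) (at 0)"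
    by (simp add: has_field_derivative_def scaleR mult.commute[of _ "D i"])
  then show ?thesis
    unfolding partial_deriv_def by (rule DERIV_imp_deriv)
qed

lemma has_derivative_norm_comp:
  fixes x :: "'a::real_inner"
  assumes "x \<noteq> 0" "(w has_real_derivative d) (at (norm x))"
  shows "((\<lambda>y. w (norm y)) has_derivative (\<lambda>v. d * (x \<bullet> v) / norm x)) (at x)"
proof -
  have "(norm has_derivative (\<lambda>v. x \<bullet> v / norm x)) (at x)"
    using has_derivative_norm[OF assms(1)] by (simp add: sgn_div_norm inner_commute divide_inverse mult.commute)
  then show ?thesis
    using has_derivative_compose assms(2)[unfolded has_field_derivative_def] by fastforce
qed

text \<open>Transfers one-sided limits of a radial profile at 0 to limits at the origin of the
  space.\<close>

lemma filterlim_norm_at_0: "filterlim norm (at 0 within {0..}) (at (0::'a::real_normed_vector))"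
  by (auto simp: filterlim_at eventually_at_filter intro: tendsto_norm_zero tendsto_ident_at)

lemma continuous_on_norm_comp:
  assumes "continuous_on {0..} w"
  shows "continuous_on S (\<lambda>x. w (norm x))"
  by (rule continuous_on_compose2[OF assms]) (auto intro: continuous_intros)

text \<open>Away from the origin the factor \<open>norm x\<close> in the profile's derivative
  cancels the one in the gradient of the norm. At the origin the profile has one-sided derivative 0,
  hence the composite has derivative zero.\<close>

lemma radial_integral_norm_has_derivative:
  fixes x :: "'a::euclidean_space"
  assumes "N \<ge> 2" "continuous_on {0..} f"
  shows "((\<lambda>x. c + radial_integral N f (norm x)) has_derivative
          (\<lambda>v. radial_mean N f (norm x) * (x \<bullet> v))) (at x)"
proof (cases "x = 0")
  case False
  then have "at (norm x) within {0..} = at (norm x)"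
    by (intro at_within_interior) auto
  then have "((\<lambda>r. c + radial_integral N f r) has_real_derivative norm x * radial_mean N f (norm x)) (at (norm x))"
    using radial_integral_has_derivative[OF assms, of "norm x"] by (auto intro!: derivative_eq_intros)
  from has_derivative_norm_comp[OF False this] show ?thesis
    using False by simp
next
  case True
  have "((\<lambda>r. radial_integral N f r / r) \<longlongrightarrow> 0) (at 0 within {0..})"
    using radial_integral_has_derivative[OF assms, of 0] by (simp add: has_field_derivative_iff)
  then have "((\<lambda>y::'a. radial_integral N f (norm y) / norm y) \<longlongrightarrow> 0) (at 0)"
    by (rule filterlim_compose) (rule filterlim_norm_at_0)
  from tendsto_norm_zero[OF this] show ?thesis
    using True by (simp add: has_derivative_iff_norm)
qed

text \<open>At \<open>x = 0\<close> the first summand of the derivative vanishes, by the convention for division by zero.\<close>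

lemma radial_mean_inner_has_derivative:
  fixes x i :: "'a::euclidean_space"
  assumes "N \<ge> 1" "continuous_on {0..} f"
  shows "((\<lambda>x. radial_mean N f (norm x) * (x \<bullet> i)) has_derivative
          (\<lambda>v. (f (norm x) - real N * radial_mean N f (norm x)) * ((x \<bullet> v) * (x \<bullet> i) / (norm x)\<^sup>2)
             + radial_mean N f (norm x) * (v \<bullet> i))) (at x)"
proof (cases "x = 0")
  case False
  then have "norm x > 0" by simp
  from has_derivative_norm_comp[OF False radial_mean_has_derivative[OF assms this]] False
  show ?thesis
    by (auto intro!: derivative_eq_intros simp: field_simps power2_eq_square)
next
  case True
  let ?p = "\<lambda>y::'a. radial_mean N f (norm y)"
  have "continuous (at 0) ?p"
    using continuous_on_norm_comp[OF continuous_on_radial_mean[OF assms(2)], of "UNIV :: 'a set" N]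
    by (simp add: continuous_on_eq_continuous_at)
  then have "((\<lambda>y. ?p y - ?p 0) \<longlongrightarrow> 0) (at 0)"
    by (simp add: continuous_at LIM_zero)
  then have lim: "((\<lambda>y. norm (?p y - ?p 0) * norm i) \<longlongrightarrow> 0) (at 0)"
    by (intro tendsto_mult_left_zero tendsto_norm_zero)
  have "((\<lambda>y. norm (?p y * (y \<bullet> i) - ?p 0 * (y \<bullet> i)) / norm y) \<longlongrightarrow> 0) (at 0)"
  proof (rule Lim_null_comparison[OF _ lim], intro always_eventually allI)
    fix y :: 'a
    have "\<bar>y \<bullet> i\<bar> / norm y \<le> norm i"
      using Cauchy_Schwarz_ineq2[of y i] by (cases "y = 0") (auto simp: divide_le_eq mult.commute)
    then have "\<bar>?p y - ?p 0\<bar> * (\<bar>y \<bullet> i\<bar> / norm y) \<le> \<bar>?p y - ?p 0\<bar> * norm i"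
      by (intro mult_left_mono) auto
    then show "norm (norm (?p y * (y \<bullet> i) - ?p 0 * (y \<bullet> i)) / norm y) \<le> norm (?p y - ?p 0) * norm i"
      by (simp add: left_diff_distrib[symmetric] abs_mult)
  qed
  moreover have "bounded_linear (\<lambda>v. ?p 0 * (v \<bullet> i))"
    by (intro bounded_linear_intros)
  ultimately show ?thesis
    using True by (simp add: has_derivative_iff_norm)
qed

text \<open>The Hessian is \<open>?\<psi>\<close> times the projection onto the radial direction,
  plus the mean times the identity. Its trace is \<open>?\<psi>\<close> plus \<open>N\<close> times
  the mean, that is, \<open>f\<close>; here \<open>N\<close> has to be the dimension.\<close>

lemma
  fixes x :: "'a::euclidean_space" and f :: "real \<Rightarrow> real" and c :: real
  assumes "N \<ge> 2" "N = DIM('a)" "continuous_on {0..} f"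
  defines "u \<equiv> \<lambda>x::'a. c + radial_integral N f (norm x)"
  shows C2_space_radial_integral: "C2_space u"
    and laplacian_radial_integral: "laplacian u x = f (norm x)"
proof -
  have N1: "N \<ge> 1" using assms(1) by simp
  have D1: "(u has_derivative (\<lambda>v. radial_mean N f (norm x) * (x \<bullet> v))) (at x)" for x
    unfolding u_def by (rule radial_integral_norm_has_derivative[OF assms(1,3)])
  have p1: "partial_deriv i u = (\<lambda>x. radial_mean N f (norm x) * (x \<bullet> i))" for i
    using partial_deriv_eqI[OF D1] by auto
  let ?\<psi> = "\<lambda>r. f r - real N * radial_mean N f r"
  let ?w = "\<lambda>i j (x::'a). ?\<psi> (norm x) * ((x \<bullet> j) * (x \<bullet> i) / (norm x)\<^sup>2)"
  let ?q = "\<lambda>i j x. ?w i j x + radial_mean N f (norm x) * (j \<bullet> i)"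
  have D2: "(partial_deriv i u has_derivative (\<lambda>v. ?q i v x)) (at x)" for i x
    unfolding p1 by (rule radial_mean_inner_has_derivative[OF N1 assms(3)])
  have p2: "partial_deriv j (partial_deriv i u) = ?q i j" for i j
    using partial_deriv_eqI[OF D2] by auto
  have cont_mean: "continuous_on UNIV (\<lambda>x::'a. radial_mean N f (norm x))"
    by (intro continuous_on_norm_comp continuous_on_radial_mean assms)
  have cont_\<psi>: "continuous_on UNIV (\<lambda>x::'a. ?\<psi> (norm x))"
    by (intro continuous_intros cont_mean continuous_on_norm_comp assms)
  have cont_w: "continuous_on UNIV (?w i j)" if ij: "i \<in> Basis" "j \<in> Basis" for i j
    unfolding continuous_on_eq_continuous_at[OF open_UNIV]
  proof
    fix x :: 'a
    show "isCont (?w i j) x"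
    proof (cases "x = 0")
      case False
      have "isCont (\<lambda>x. ?\<psi> (norm x)) x"
        using cont_\<psi> by (simp add: continuous_on_eq_continuous_at)
      moreover have "isCont (\<lambda>x. (x \<bullet> j) * (x \<bullet> i) / (norm x)\<^sup>2) x"
        using False by (intro continuous_intros) auto
      ultimately show ?thesis
        by (rule isCont_mult)
    next
      case True
      have "((\<lambda>x::'a. ?\<psi> (norm x)) \<longlongrightarrow> ?\<psi> (norm (0::'a))) (at 0)"
        using cont_\<psi>[unfolded continuous_on_def, THEN bspec, of 0] by simp
      \<comment> \<open>The angular factor is bounded but has no limit at the origin in general.
        Continuity comes from \<open>?\<psi> 0 = 0\<close>, because the mean at 0 is
        \<open>f 0 / N\<close>.\<close>
      then have lim: "((\<lambda>x::'a. \<bar>?\<psi> (norm x)\<bar>) \<longlongrightarrow> 0) (at 0)"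
        using N1 by (simp add: radial_mean_0 tendsto_rabs_zero)
      have "(?w i j \<longlongrightarrow> 0) (at 0)"
      proof (rule Lim_null_comparison[OF _ lim], intro always_eventually allI)
        fix y :: 'a
        have "\<bar>y \<bullet> j\<bar> * \<bar>y \<bullet> i\<bar> \<le> norm y * norm y"
          using ij by (intro mult_mono Basis_le_norm) auto
        then have "\<bar>(y \<bullet> j) * (y \<bullet> i) / (norm y)\<^sup>2\<bar> \<le> 1"
          by (cases "y = 0") (auto simp: abs_mult power2_eq_square divide_le_eq)
        then show "norm (?w i j y) \<le> \<bar>?\<psi> (norm y)\<bar>"
          unfolding real_norm_def abs_mult[of "?\<psi> (norm y)"] by (intro mult_left_le) auto
      qed
      then show ?thesis using True by (simp add: continuous_at)
    qed
  qed
  have "C1_space u"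
    unfolding C1_space_def p1
    using D1 cont_mean by (auto intro!: differentiableI continuous_intros)
  moreover have "C1_space (partial_deriv i u)" if "i \<in> Basis" for i
    unfolding C1_space_def p2
    using D2 cont_mean cont_w that by (auto intro!: differentiableI continuous_on_add continuous_on_mult_right)
  ultimately show "C2_space u"
    by (simp add: C2_space_def)
  have "(\<Sum>i\<in>Basis. (x \<bullet> i) * (x \<bullet> i)) = (norm x)\<^sup>2"
    by (simp add: power2_norm_eq_inner euclidean_inner[of x x])
  \<comment> \<open>At \<open>x = 0\<close> both sides are 0: the left by division by zero, the
    right by \<open>radial_mean_0\<close>.\<close>
  then have "(\<Sum>i\<in>Basis. ?w i i x) = ?\<psi> (norm x)"
    using N1 by (cases "x = 0") (auto simp: sum_distrib_left[symmetric] sum_divide_distrib[symmetric] radial_mean_0)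
  then show "laplacian u x = f (norm x)"
    unfolding laplacian_def p2 by (simp add: sum.distrib assms(2))
qed

subsection \<open>Monotone convergence\<close>

lemma continuous_on_Ici_imp_Icc:
  fixes c :: "'a::linorder_topology"
  shows "continuous_on {c..} f \<Longrightarrow> continuous_on {c..d} f"
  by (rule continuous_on_subset[of "{c..}"]) auto

lemma continuous_on_Ici_bounded_above:
  fixes f :: "real \<Rightarrow> real"
  assumes "continuous_on {c..} f"
  obtains M where "\<And>s. s \<in> {c..d} \<Longrightarrow> f s \<le> M"
proof -
  have "bdd_above (f ` {c..d})"
    by (intro bounded_imp_bdd_above compact_imp_bounded compact_continuous_image
        continuous_on_Ici_imp_Icc assms compact_Icc)
  then obtain M where "\<forall>s\<in>{c..d}. f s \<le> M" by (auto simp: bdd_above_def)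
  then show ?thesis using that[of M] by blast
qed

lemma radial_integral_neg: "r < 0 \<Longrightarrow> radial_integral N f r = 0"
  by (simp add: radial_integral_def)

text \<open>The derivative \<open>r * radial_mean N f r\<close> is at most \<open>c * M\<close> in
  absolute value. The constant depends on \<open>f\<close> only through the bound \<open>M\<close>,
  so it can serve all iterates at once.\<close>

lemma radial_integral_lipschitz:
  assumes N: "N \<ge> 2" and f: "continuous_on {0..} f"
    and bound: "\<And>s. 0 \<le> s \<Longrightarrow> s \<le> c \<Longrightarrow> \<bar>f s\<bar> \<le> M" and xy: "x \<in> {0..c}" "y \<in> {0..c}"
  shows "\<bar>radial_integral N f x - radial_integral N f y\<bar> \<le> c * M * \<bar>x - y\<bar>"
  unfolding real_norm_def[symmetric]
proof (rule field_differentiable_bound[OF convex_real_interval(5) _ _ xy])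
  fix r assume r: "r \<in> {0..c}"
  show "(radial_integral N f has_field_derivative r * radial_mean N f r) (at r within {0..c})"
    using r by (intro DERIV_subset[OF radial_integral_has_derivative[OF N f]]) auto
  have M: "M \<ge> 0" using bound[of 0] r by force
  have "radial_mean N f r \<le> radial_mean N (\<lambda>s. M) r" "radial_mean N (\<lambda>s. - M) r \<le> radial_mean N f r"
    using r bound by (intro radial_mean_mono continuous_intros f; force)+
  moreover have "M / real N \<le> M"
    using N M mult_left_mono[of 1 "real N" M] by (simp add: divide_le_eq)
  ultimately have "\<bar>radial_mean N f r\<bar> \<le> M"
    using N by (simp add: radial_mean_const)
  then show "norm (r * radial_mean N f r) \<le> c * M"
    using r by (auto simp: abs_mult intro!: mult_mono)
qed

text \<open>The sets \<open>K n\<close> where the gap to the limit is at least \<open>e\<close> are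
  compact and decreasing. Were all of them nonempty, a common point would contradict pointwise
  convergence there.\<close>

lemma dini:
  fixes f :: "nat \<Rightarrow> 'a::heine_borel \<Rightarrow> real"
  assumes S: "compact S" and f: "\<And>n. continuous_on S (f n)" and l: "continuous_on S l"
    and inc: "\<And>n x. x \<in> S \<Longrightarrow> f n x \<le> f (Suc n) x"
    and lim: "\<And>x. x \<in> S \<Longrightarrow> (\<lambda>n. f n x) \<longlonglongrightarrow> l x"
  shows "uniform_limit S f l sequentially"
proof (rule uniform_limitI)
  fix e :: real assume e: "e > 0"
  define K where "K n = S \<inter> (\<lambda>x. l x - f n x) -` {e..}" for n
  have mono: "f m x \<le> f n x" if "x \<in> S" "m \<le> n" for x m n
    using that(2) by (rule lift_Suc_mono_le[of "\<lambda>n. f n x", OF inc[OF that(1)]])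
  have below: "f n x \<le> l x" if "x \<in> S" for n x
    using lim[OF that] by (rule LIMSEQ_le_const) (use mono[OF that] in blast)
  have "\<exists>n. K n = {}"
  proof (rule ccontr)
    assume ne: "\<nexists>n. K n = {}"
    have "\<Inter> (range K) \<noteq> {}"
    proof (rule compact_nest)
      show "compact (K n)" for n
      proof -
        have "closed (K n)"
          unfolding K_def using S f l
          by (intro continuous_closed_preimage continuous_intros) (auto simp: compact_imp_closed)
        moreover have "K n = S \<inter> K n" by (auto simp: K_def)
        ultimately show ?thesis using S by (metis compact_Int_closed)
      qed
      show "K n \<subseteq> K m" if "m \<le> n" for m n
        using mono[OF _ that] by (force simp: K_def)
    qed (use ne in auto)
    then obtain x where x: "\<And>n. x \<in> K n" by blast
    then have "x \<in> S" by (auto simp: K_def)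
    moreover have "f n x \<le> l x - e" for n
      using x[of n] by (auto simp: K_def)
    ultimately have "l x \<le> l x - e"
      using LIMSEQ_le_const2[OF lim] by blast
    with e show False by simp
  qed
  then obtain n where n: "K n = {}" by blast
  have "dist (f m x) (l x) < e" if "x \<in> S" "m \<ge> n" for m x
    using n mono[OF that] below[OF that(1), of m] that(1) by (force simp: K_def dist_real_def)
  then show "\<forall>\<^sub>F m in sequentially. \<forall>x\<in>S. dist (f m x) (l x) < e"
    by (auto simp: eventually_sequentially)
qed

lemma mono_on_bounded_tendsto_at_top:
  fixes u :: "real \<Rightarrow> real"
  assumes mono: "mono_on {c..} u" and bound: "\<And>r. r \<ge> c \<Longrightarrow> u r \<le> T"
  shows "\<exists>L. (u \<longlongrightarrow> L) at_top"
proof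
  have bdd: "bdd_above (u ` {c..})" using bound by (auto intro!: bdd_aboveI)
  show "(u \<longlongrightarrow> Sup (u ` {c..})) at_top"
  proof (rule increasing_tendsto)
    show "\<forall>\<^sub>F r in at_top. u r \<le> Sup (u ` {c..})"
      using eventually_ge_at_top[of c] by eventually_elim (auto intro!: cSup_upper bdd)
    fix x assume "x < Sup (u ` {c..})"
    then obtain r where r: "r \<ge> c" "x < u r"
      using bdd by (subst (asm) less_cSup_iff) auto
    show "\<forall>\<^sub>F r in at_top. x < u r"
      using eventually_ge_at_top[of r]
      by eventually_elim (use r mono_onD[OF mono, of r] in \<open>force intro: less_le_trans\<close>)
  qed
qed

subsection \<open>The iteration and its limit\<close>

text \<open>Iterates started at \<open>u0\<close> never drop below it, so the assumptions on
  \<open>h\<close> and \<open>g\<close> concern \<open>{u0..}\<close> alone, where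
  \<open>h + g\<close> is positive. The Osgood integral starts at \<open>u0\<close> itself, which
  makes it vanish at the initial value.\<close>

locale monotone_radial_problem =
  fixes N :: nat and a b h g :: "real \<Rightarrow> real" and u0 :: real
  assumes N: "N \<ge> 2"
    and a_cont: "continuous_on {0..} a" and a_nonneg: "\<And>s. s \<ge> 0 \<Longrightarrow> a s \<ge> 0"
    and b_cont: "continuous_on {0..} b" and b_nonneg: "\<And>s. s \<ge> 0 \<Longrightarrow> b s \<ge> 0"
    and h_cont: "continuous_on {u0..} h" and h_mono: "mono_on {u0..} h" and h_pos: "h u0 > 0"
    and g_cont: "continuous_on {u0..} g" and g_mono: "mono_on {u0..} g" and g_nonneg: "g u0 \<ge> 0"
    and osgood: "filterlim (\<lambda>t. integral {u0..t} (\<lambda>\<tau>. 1 / (h \<tau> + g \<tau>))) at_top at_top"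
begin

declare radial_iterate.simps(2) [simp del]

definition source :: "(real \<Rightarrow> real) \<Rightarrow> real \<Rightarrow> real" where
  "source w s = a s * h (w s) + b s * g (w s)"

text \<open>The time that the scalar equation \<open>y' = h y + g y\<close> takes to move from
  \<open>u0\<close> to \<open>t\<close>; the Osgood condition excludes blow-up in finite
  time.\<close>

definition osgood_integral :: "real \<Rightarrow> real" where
  "osgood_integral t = integral {u0..t} (\<lambda>\<tau>. 1 / (h \<tau> + g \<tau>))"

abbreviation iterate :: "nat \<Rightarrow> real \<Rightarrow> real" where
  "iterate \<equiv> radial_iterate N a b h g u0"

abbreviation total_weight :: "real \<Rightarrow> real" where
  "total_weight \<equiv> radial_integral N (\<lambda>s. a s + b s)"

lemma iterate_Suc: "iterate (Suc n) = (\<lambda>r. u0 + radial_integral N (source (iterate n)) r)"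
  by (simp add: source_def[abs_def] radial_iterate.simps(2))

lemma h_ge: "s \<ge> u0 \<Longrightarrow> h s \<ge> h u0" and g_ge: "s \<ge> u0 \<Longrightarrow> g s \<ge> g u0"
  using mono_onD[OF h_mono, of u0 s] mono_onD[OF g_mono, of u0 s] by auto

lemma sum_pos: "s \<ge> u0 \<Longrightarrow> h s + g s > 0"
  using h_ge[of s] g_ge[of s] h_pos g_nonneg by linarith

lemma continuous_on_source:
  assumes "continuous_on {0..} w" "\<And>r. r \<ge> 0 \<Longrightarrow> u0 \<le> w r"
  shows "continuous_on {0..} (source w)"
  unfolding source_def[abs_def] using assms
  by (intro continuous_intros a_cont b_cont continuous_on_compose2[OF h_cont]
      continuous_on_compose2[OF g_cont]) auto

lemma source_mono: "s \<ge> 0 \<Longrightarrow> u0 \<le> w s \<Longrightarrow> w s \<le> v s \<Longrightarrow> source w s \<le> source v s"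
  unfolding source_def
  by (intro add_mono mult_left_mono a_nonneg b_nonneg mono_onD[OF h_mono] mono_onD[OF g_mono]) auto

lemma source_nonneg: "s \<ge> 0 \<Longrightarrow> u0 \<le> w s \<Longrightarrow> source w s \<ge> 0"
  unfolding source_def using h_ge[of "w s"] g_ge[of "w s"] h_pos g_nonneg
  by (intro add_nonneg_nonneg mult_nonneg_nonneg a_nonneg b_nonneg) auto

text \<open>Adding the nonnegative cross terms \<open>a s * g t\<close> and \<open>b s * h t\<close>
  lets the bound split into a factor depending on \<open>t\<close> and the weight
  \<open>a s + b s\<close>.\<close>

lemma source_le:
  assumes "s \<ge> 0" "u0 \<le> w s" "w s \<le> t"
  shows "source w s \<le> (h t + g t) * (a s + b s)"
proof -
  have "0 \<le> h t" "0 \<le> g t"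
    using h_ge[of t] g_ge[of t] h_pos g_nonneg assms by auto
  then have "0 \<le> a s * g t" "0 \<le> b s * h t"
    using assms a_nonneg b_nonneg by auto
  with source_mono[of s w "\<lambda>_. t"] assms show ?thesis
    by (simp add: source_def algebra_simps)
qed

text \<open>The two claims need a joint induction: continuity of the source requires values in
  \<open>{u0..}\<close>, and the lower bound for the next iterate uses continuity of the
  source.\<close>

lemma iterate_continuous_ge: "continuous_on {0..} (iterate n) \<and> (\<forall>r\<ge>0. u0 \<le> iterate n r)"
proof (induction n)
  case (Suc n)
  then have *: "continuous_on {0..} (source (iterate n))" by (intro continuous_on_source) auto
  then have "0 \<le> radial_integral N (source (iterate n)) r" if "r \<ge> 0" for r
    using N Suc that by (intro radial_integral_nonneg source_nonneg) auto
  with * N show ?case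
    unfolding iterate_Suc by (auto intro!: continuous_intros continuous_on_radial_integral)
qed simp

lemmas continuous_on_iterate = iterate_continuous_ge[THEN conjunct1]
lemmas iterate_ge = iterate_continuous_ge[THEN conjunct2, rule_format]

lemma continuous_on_source_iterate: "continuous_on {0..} (source (iterate n))"
  by (intro continuous_on_source continuous_on_iterate iterate_ge)

lemma iterate_le_Suc: "r \<ge> 0 \<Longrightarrow> iterate n r \<le> iterate (Suc n) r"
proof (induction n arbitrary: r)
  case 0
  then show ?case using iterate_ge[of r "Suc 0"] by simp
next
  case (Suc n)
  then show ?case
    unfolding iterate_Suc[of n] iterate_Suc[of "Suc n"]
    by (intro add_left_mono radial_integral_mono N continuous_on_source_iterate
        source_mono iterate_ge) (auto simp flip: iterate_Suc intro: continuous_on_source_iterate)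
qed

section \<open>The Osgood estimate and bounds uniform in the index\<close>

lemma reciprocal_continuous: "continuous_on {u0..} (\<lambda>\<tau>. 1 / (h \<tau> + g \<tau>))"
  by (intro continuous_intros h_cont g_cont) (use sum_pos in force)

lemma osgood_integral_has_derivative:
  "t \<ge> u0 \<Longrightarrow> (osgood_integral has_real_derivative 1 / (h t + g t)) (at t within {u0..})"
  unfolding osgood_integral_def[abs_def]
  by (rule integral_Ici_has_real_derivative[OF reciprocal_continuous])

lemma osgood_bound_exists:
  obtains T where "T > u0" "\<And>t. t \<ge> u0 \<Longrightarrow> osgood_integral t \<le> L \<Longrightarrow> t \<le> T"
proof -
  from osgood obtain T where T: "\<And>t. t \<ge> T \<Longrightarrow> osgood_integral t > L"
    unfolding filterlim_at_top_dense eventually_at_top_linorder osgood_integral_def by blast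
  \<comment> \<open>The maximum with \<open>u0 + 1\<close> secures the strict inequality
    \<open>T > u0\<close> that (A1) asks for.\<close>
  show ?thesis
  proof (rule that[of "max T (u0 + 1)"])
    show "t \<le> max T (u0 + 1)" if "osgood_integral t \<le> L" for t
      using T[of t] that by linarith
  qed auto
qed

text \<open>The difference of the two sides vanishes at 0 and has nonnegative derivative. Keeping
  \<open>w\<close> and \<open>v\<close> apart covers both consecutive iterates and, with
  \<open>w = v\<close>, the limit.\<close>

lemma osgood_integral_le_total_weight:
  assumes w: "continuous_on {0..} w" "\<And>r. r \<ge> 0 \<Longrightarrow> u0 \<le> w r"
    and v: "\<And>r. r \<ge> 0 \<Longrightarrow> v r = u0 + radial_integral N (source w) r"
    and wv: "\<And>r. r \<ge> 0 \<Longrightarrow> w r \<le> v r" and r: "r \<ge> 0"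
  shows "osgood_integral (v r) \<le> total_weight r"
proof -
  have cont: "continuous_on {0..} (source w)" by (intro continuous_on_source w)
  have v_mono: "v x \<le> v y" if "0 \<le> x" "x \<le> y" for x y
    using mono_onD[OF mono_on_radial_integral[OF N cont], of x y] source_nonneg w(2) that v by auto
  have v_ge: "v x \<ge> u0" if "x \<ge> 0" for x
    using w(2) wv that order_trans by blast
  have v_deriv: "(v has_real_derivative x * radial_mean N (source w) x) (at x within {0..})"
    if "x \<ge> 0" for x
    by (rule has_field_derivative_transform_within[of "\<lambda>r. u0 + radial_integral N (source w) r" _ _ _ 1])
       (use that v in \<open>auto intro!: derivative_eq_intros radial_integral_has_derivative[OF N cont]\<close>)
  have cont_ab: "continuous_on {0..} (\<lambda>s. a s + b s)"
    by (intro continuous_intros a_cont b_cont)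
  have "mono_on {0..} (\<lambda>x. total_weight x - osgood_integral (v x))"
  proof (rule mono_on_if_derivative_nonneg)
    fix x :: real assume x: "x \<ge> 0"
    \<comment> \<open>At \<open>u0\<close> this derivative is one-sided, so the chain rule is
      applied within the image of \<open>v\<close>, which lies in \<open>{u0..}\<close>.\<close>
    have "(osgood_integral has_real_derivative 1 / (h (v x) + g (v x))) (at (v x) within v ` {0..})"
      by (rule DERIV_subset[OF osgood_integral_has_derivative]) (use v_ge x in auto)
    from DERIV_image_chain[OF this v_deriv[OF x]]
    have "((\<lambda>x. osgood_integral (v x)) has_real_derivative
        1 / (h (v x) + g (v x)) * (x * radial_mean N (source w) x)) (at x within {0..})"
      by (simp add: o_def)
    then show "((\<lambda>x. total_weight x - osgood_integral (v x)) has_real_derivative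
        x * radial_mean N (\<lambda>s. a s + b s) x
          - 1 / (h (v x) + g (v x)) * (x * radial_mean N (source w) x)) (at x within {0..})"
      by (intro derivative_intros radial_integral_has_derivative[OF N cont_ab x])
    \<comment> \<open>For \<open>s \<le> x\<close> one has \<open>w s \<le> v s \<le> v x\<close>,
      so the factor \<open>h (v x) + g (v x)\<close> does not depend on \<open>s\<close> and can
      leave the mean.\<close>
    have "radial_mean N (source w) x \<le> radial_mean N (\<lambda>s. (h (v x) + g (v x)) * (a s + b s)) x"
    proof (rule radial_mean_mono[OF cont _ x])
      fix s assume s: "0 \<le> s" "s \<le> x"
      show "source w s \<le> (h (v x) + g (v x)) * (a s + b s)"
        using wv[OF s(1)] v_mono[OF s] w(2)[OF s(1)] s by (intro source_le) auto
    qed (intro continuous_intros a_cont b_cont)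
    then have "radial_mean N (source w) x \<le> (h (v x) + g (v x)) * radial_mean N (\<lambda>s. a s + b s) x"
      unfolding radial_mean_cmult .
    then have "radial_mean N (source w) x / (h (v x) + g (v x)) \<le> radial_mean N (\<lambda>s. a s + b s) x"
      using sum_pos[OF v_ge[OF x]] by (simp add: divide_le_eq mult.commute)
    from mult_left_mono[OF this x]
    show "0 \<le> x * radial_mean N (\<lambda>s. a s + b s) x
          - 1 / (h (v x) + g (v x)) * (x * radial_mean N (source w) x)"
      by simp
  qed
  from mono_onD[OF this, of 0 r] r v[of 0] show ?thesis
    by (simp add: osgood_integral_def)
qed

lemma total_weight_mono: "mono_on {0..} total_weight"
  using N a_nonneg b_nonneg by (intro mono_on_radial_integral continuous_intros a_cont b_cont) auto

lemma iterate_bound: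
  obtains T where "T > u0" "\<And>n r. r \<in> {0..c} \<Longrightarrow> iterate n r \<le> T"
proof -
  obtain T where T: "T > u0" "\<And>t. t \<ge> u0 \<Longrightarrow> osgood_integral t \<le> total_weight c \<Longrightarrow> t \<le> T"
    using osgood_bound_exists by blast
  have "iterate n r \<le> T" if r: "r \<in> {0..c}" for n r
  proof (cases n)
    case (Suc k)
    have "osgood_integral (iterate (Suc k) r) \<le> total_weight r"
      using r by (intro osgood_integral_le_total_weight[of "iterate k"] continuous_on_iterate
          iterate_ge iterate_le_Suc) (auto simp: iterate_Suc)
    also have "\<dots> \<le> total_weight c"
      using r by (intro mono_onD[OF total_weight_mono]) auto
    finally show ?thesis using Suc T(2) r iterate_ge by auto
  qed (use T(1) in simp)
  with T(1) show ?thesis by (rule that)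
qed

section \<open>The limit of the iterates\<close>

definition solution :: "real \<Rightarrow> real" where
  "solution r = lim (\<lambda>n. iterate n r)"

lemma iterate_tendsto: "r \<ge> 0 \<Longrightarrow> (\<lambda>n. iterate n r) \<longlonglongrightarrow> solution r"
proof -
  assume r: "r \<ge> 0"
  obtain T where T: "\<And>n r'. r' \<in> {0..r} \<Longrightarrow> iterate n r' \<le> T" using iterate_bound by blast
  have "incseq (\<lambda>n. iterate n r)"
    using iterate_le_Suc[OF r] by (rule incseq_SucI)
  then have "convergent (\<lambda>n. iterate n r)"
    using T[of r] r by (auto intro: incseq_convergent[of _ T] simp: convergent_def)
  then show ?thesis
    by (simp add: solution_def convergent_LIMSEQ_iff)
qed

lemma solution_ge: "r \<ge> 0 \<Longrightarrow> u0 \<le> solution r"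
  using iterate_tendsto by (rule LIMSEQ_le_const) (use iterate_ge in auto)

text \<open>On \<open>{0..c}\<close> all sources are bounded by one \<open>M\<close>, so the
  iterates share a Lipschitz constant, which survives the pointwise limit.\<close>

lemma solution_lipschitz:
  obtains K where "\<And>x y. x \<in> {0..c} \<Longrightarrow> y \<in> {0..c} \<Longrightarrow> \<bar>solution x - solution y\<bar> \<le> K * \<bar>x - y\<bar>"
proof -
  obtain T where T: "T > u0" "\<And>n r. r \<in> {0..c} \<Longrightarrow> iterate n r \<le> T" using iterate_bound by blast
  have "continuous_on {0..} (\<lambda>s. (h T + g T) * (a s + b s))"
    by (intro continuous_intros a_cont b_cont)
  then obtain M where M: "\<And>s. s \<in> {0..c} \<Longrightarrow> (h T + g T) * (a s + b s) \<le> M"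
    using continuous_on_Ici_bounded_above by blast
  have F: "\<bar>source (iterate n) s\<bar> \<le> M" if "0 \<le> s" "s \<le> c" for n s
    using source_le[of s "iterate n" T] source_nonneg[of s "iterate n"] that T(2)[of s] M[of s] iterate_ge[of s]
    by fastforce
  have "\<bar>solution x - solution y\<bar> \<le> c * M * \<bar>x - y\<bar>" if xy: "x \<in> {0..c}" "y \<in> {0..c}" for x y
  proof (rule LIMSEQ_le_const2)
    \<comment> \<open>The shift leaves the limit unchanged and gives access to the form
      \<open>u0\<close> plus a radial integral.\<close>
    show "(\<lambda>n. \<bar>iterate (Suc n) x - iterate (Suc n) y\<bar>) \<longlonglongrightarrow> \<bar>solution x - solution y\<bar>"
      using xy by (intro tendsto_intros LIMSEQ_Suc iterate_tendsto) auto
    show "\<exists>N. \<forall>n\<ge>N. \<bar>iterate (Suc n) x - iterate (Suc n) y\<bar> \<le> c * M * \<bar>x - y\<bar>"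
      using radial_integral_lipschitz[OF N continuous_on_source_iterate F xy]
      by (auto simp: iterate_Suc)
  qed
  then show ?thesis by (rule that)
qed

text \<open>The Lipschitz bound on \<open>{0..x + 1}\<close> covers a neighbourhood of
  \<open>x\<close> in the half-line. Dini's theorem requires this continuity of the limit.\<close>

lemma continuous_on_solution: "continuous_on {0..} solution"
  unfolding continuous_on_eq_continuous_within
proof
  fix x :: real assume x: "x \<in> {0..}"
  obtain K where K: "\<And>y z. y \<in> {0..x + 1} \<Longrightarrow> z \<in> {0..x + 1} \<Longrightarrow> \<bar>solution y - solution z\<bar> \<le> K * \<bar>y - z\<bar>"
    using solution_lipschitz by blast
  have "((\<lambda>y. K * \<bar>y - x\<bar>) \<longlongrightarrow> K * \<bar>x - x\<bar>) (at x within {0..x + 1})"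
    by (intro tendsto_intros)
  then have "((\<lambda>y. K * \<bar>y - x\<bar>) \<longlongrightarrow> 0) (at x within {0..x + 1})" by simp
  moreover have "\<forall>\<^sub>F y in at x within {0..x + 1}. norm (solution y - solution x) \<le> K * \<bar>y - x\<bar>"
    using K x by (auto simp: eventually_at_filter)
  ultimately have "((\<lambda>y. solution y - solution x) \<longlongrightarrow> 0) (at x within {0..x + 1})"
    by (rule Lim_null_comparison[rotated])
  then show "continuous (at x within {0..}) solution"
    using x by (simp add: continuous_within at_within_Ici_restrict Lim_null[symmetric])
qed

lemma uniform_limit_iterate: "uniform_limit {0..c} iterate solution sequentially"
  by (intro dini continuous_on_Ici_imp_Icc continuous_on_iterate continuous_on_solution)
     (auto intro: iterate_le_Suc iterate_tendsto)

lemma locally_uniform_limit_iterate: "locally_uniform_limit {0..} iterate solution"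
  unfolding locally_uniform_limit_def
proof
  fix x :: real
  have "ball x 1 \<inter> {0..} \<subseteq> {0..x + 1}" by (auto simp: dist_real_def)
  then show "\<exists>d>0. uniform_limit (ball x d \<inter> {0..}) iterate solution sequentially"
    by (intro exI[of _ 1]) (auto intro: uniform_limit_on_subset[OF uniform_limit_iterate])
qed

lemma continuous_on_source_solution: "continuous_on {0..} (source solution)"
  by (intro continuous_on_source continuous_on_solution solution_ge)

lemma source_iterate_tendsto:
  assumes s: "s \<ge> 0"
  shows "(\<lambda>n. source (iterate n) s) \<longlonglongrightarrow> source solution s"
  unfolding source_def
  by (intro tendsto_intros continuous_on_tendsto_compose[OF h_cont]
      continuous_on_tendsto_compose[OF g_cont] iterate_tendsto[OF s])
     (use s solution_ge iterate_ge in auto)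

text \<open>The sources again increase with \<open>n\<close> to a continuous limit, so Dini's
  theorem applies to them directly, without uniform continuity of \<open>h\<close> and
  \<open>g\<close>.\<close>

lemma uniform_limit_source_iterate:
  "uniform_limit {0..c} (\<lambda>n. source (iterate n)) (source solution) sequentially"
proof (rule dini)
  show "source (iterate n) x \<le> source (iterate (Suc n)) x" if "x \<in> {0..c}" for n x
    using that by (intro source_mono iterate_ge iterate_le_Suc) auto
qed (auto intro: source_iterate_tendsto continuous_on_Ici_imp_Icc continuous_on_source_iterate
      continuous_on_source_solution)

text \<open>An equation between total functions, convenient for rewriting: at negative arguments
  every iterate is \<open>u0\<close> and the radial integral is 0, so both sides equal
  \<open>u0\<close>.\<close>

lemma solution_eq: "solution = (\<lambda>r. u0 + radial_integral N (source solution) r)"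
proof
  fix r
  show "solution r = u0 + radial_integral N (source solution) r"
  proof (cases "r \<ge> 0")
    case False
    then have "iterate n r = u0" for n by (cases n) (auto simp: radial_integral_neg iterate_Suc)
    with False show ?thesis by (simp add: solution_def radial_integral_neg)
  next
    case r: True
    have "(\<lambda>n. radial_integral N (source (iterate n)) r) \<longlonglongrightarrow> radial_integral N (source solution) r"
    proof (rule LIMSEQ_I)
      fix e :: real assume e: "e > 0"
      \<comment> \<open>Chosen so that \<open>d * r\<^sup>2 < e\<close>; the summand 1 covers
        \<open>r = 0\<close>.\<close>
      define d where "d = e / (1 + r\<^sup>2)"
      have "1 + r\<^sup>2 > 0" by (simp add: add_pos_nonneg)
      with e have d: "d > 0" "d * r\<^sup>2 < e"
        unfolding d_def by (auto simp: pos_divide_less_eq distrib_left intro: divide_pos_pos)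
      from uniform_limitD[OF uniform_limit_source_iterate d(1), of r]
      obtain n0 where n0: "\<And>n s. n \<ge> n0 \<Longrightarrow> s \<in> {0..r} \<Longrightarrow> dist (source (iterate n) s) (source solution s) < d"
        unfolding eventually_sequentially by blast
      have "\<bar>radial_integral N (source (iterate n)) r - radial_integral N (source solution) r\<bar> \<le> d * r\<^sup>2"
        if "n \<ge> n0" for n
        using n0[OF that] by (intro radial_integral_dist_le N continuous_on_source_iterate
            continuous_on_source_solution r) (force simp: dist_real_def)
      with d(2) show "\<exists>n0. \<forall>n\<ge>n0. norm (radial_integral N (source (iterate n)) r
          - radial_integral N (source solution) r) < e"
        by (auto intro!: exI[of _ n0] intro: le_less_trans)
    qed
    then have "(\<lambda>n. iterate (Suc n) r) \<longlonglongrightarrow> u0 + radial_integral N (source solution) r"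
      unfolding iterate_Suc by (intro tendsto_intros)
    then show ?thesis
      using LIMSEQ_unique LIMSEQ_Suc[OF iterate_tendsto[OF r]] by blast
  qed
qed

section \<open>Monotonicity, bounds and behaviour at infinity of the solution\<close>

lemma solution_mono: "mono_on {0..} solution"
  using mono_onD[OF mono_on_radial_integral[OF N continuous_on_source_solution]]
    source_nonneg solution_ge
  by (subst solution_eq) (auto intro!: mono_onI)

lemma osgood_integral_solution: "r \<ge> 0 \<Longrightarrow> osgood_integral (solution r) \<le> total_weight r"
  by (rule osgood_integral_le_total_weight[of solution])
     (auto intro: continuous_on_solution solution_ge fun_cong[OF solution_eq])

lemma solution_bound: "\<exists>T>u0. \<forall>r\<in>{0..c}. solution r \<le> T"
proof -
  obtain T where "T > u0" "\<And>n r. r \<in> {0..c} \<Longrightarrow> iterate n r \<le> T" using iterate_bound by blast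
  then show ?thesis
    by (intro exI[of _ T]) (auto intro!: LIMSEQ_le_const2[OF iterate_tendsto])
qed

lemma rderiv_solution: "r \<ge> 0 \<Longrightarrow> rderiv solution r = r * radial_mean N (source solution) r"
  by (subst solution_eq) (rule rderiv_radial_integral[OF N continuous_on_source_solution])

lemma rderiv_solution_bound:
  "\<exists>K>0. \<forall>r\<in>{0..c}. 0 \<le> rderiv solution r \<and> rderiv solution r \<le> K * (r + 1)"
proof -
  let ?p = "radial_mean N (source solution)"
  obtain M where M: "\<And>s. s \<in> {0..c} \<Longrightarrow> ?p s \<le> M"
    using continuous_on_Ici_bounded_above[OF continuous_on_radial_mean[OF continuous_on_source_solution]]
    by blast
  have nonneg: "?p r \<ge> 0" if "r \<ge> 0" for r
    using that by (intro radial_mean_nonneg source_nonneg solution_ge) auto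
  \<comment> \<open>The constant \<open>\<bar>M\<bar> + 1\<close> dominates \<open>M\<close> and is
    positive, as (A2) requires.\<close>
  have "r * ?p r \<le> (\<bar>M\<bar> + 1) * (r + 1)" if r: "r \<in> {0..c}" for r
  proof -
    have "r * ?p r \<le> (r + 1) * (\<bar>M\<bar> + 1)"
      using r M[OF r] nonneg[of r] by (intro mult_mono) auto
    then show ?thesis by (simp add: mult.commute)
  qed
  then show ?thesis
    using nonneg by (intro exI[of _ "\<bar>M\<bar> + 1"]) (auto simp: rderiv_solution)
qed

text \<open>By monotonicity the source along the solution is at least its value at the constant
  \<open>u0\<close>, so the radial integral of \<open>m\<close> bounds \<open>solution - u0\<close>
  from below.\<close>

lemma solution_at_top:
  assumes m: "continuous_on {0..} m" "\<And>s. s \<ge> 0 \<Longrightarrow> m s \<le> source (\<lambda>_. u0) s"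
    and lim: "filterlim (radial_integral N m) at_top at_top"
  shows "filterlim solution at_top at_top"
proof (rule filterlim_at_top_mono)
  show "filterlim (\<lambda>r. u0 + radial_integral N m r) at_top at_top"
    by (rule filterlim_tendsto_add_at_top[OF tendsto_const lim])
  show "\<forall>\<^sub>F r in at_top. u0 + radial_integral N m r \<le> solution r"
    using eventually_ge_at_top[of 0]
  proof eventually_elim
    case (elim r)
    have "radial_integral N m r \<le> radial_integral N (source solution) r"
    proof (intro radial_integral_mono N m(1) continuous_on_source_solution)
      fix s :: real assume "0 \<le> s"
      then show "m s \<le> source solution s"
        using source_mono[of s "\<lambda>_. u0" solution] solution_ge[of s] m(2)[of s] by simp
    qed
    then show ?case by (subst solution_eq) simp
  qed
qed

text \<open>The weight is nondecreasing, hence at most its limit \<open>L\<close> everywhere. The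
  Osgood estimate turns \<open>L\<close> into one bound for the solution on the whole half-line, and
  monotonicity gives the limit.\<close>

lemma solution_convergent:
  assumes "(total_weight \<longlongrightarrow> L) at_top"
  shows "\<exists>L. (solution \<longlongrightarrow> L) at_top"
proof -
  have "total_weight r \<le> L" if r: "r \<ge> 0" for r
  proof (rule tendsto_lowerbound[OF assms])
    show "\<forall>\<^sub>F x in at_top. total_weight r \<le> total_weight x"
      using eventually_ge_at_top[of r]
      by eventually_elim (use r in \<open>auto intro: mono_onD[OF total_weight_mono]\<close>)
  qed simp
  moreover obtain T where "\<And>t. t \<ge> u0 \<Longrightarrow> osgood_integral t \<le> L \<Longrightarrow> t \<le> T"
    using osgood_bound_exists by blast
  ultimately have "solution r \<le> T" if "r \<ge> 0" for r
    using osgood_integral_solution solution_ge that order_trans by blast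
  then show ?thesis by (rule mono_on_bounded_tendsto_at_top[OF solution_mono])
qed

end

section \<open>Application to the equation on Euclidean space\<close>

theorem theorem1:
  fixes N :: nat
    and h g a b :: "real \<Rightarrow> real"
    and A B :: "real ^ 'n \<Rightarrow> real"
    and s0 u0 :: real
  assumes N: "N = CARD('n)" "N \<ge> 3"
    and h_cont: "continuous_on {0..} h"
    and h_nonneg: "\<forall>s\<ge>0. h s \<ge> 0"
    and h_mono: "mono_on {0..} h"
    and h_zero: "h 0 = 0"
    and h_pos: "\<forall>s>0. h s > 0"
    and g_cont: "continuous_on {0<..} g"
    and s0_pos: "s0 > 0"
    and g_mono: "mono_on {s0<..} g"
    and g_lim: "(g \<longlongrightarrow> 0) (at_right 0)"
    and g_s0: "g s0 = 0"
    and g_neg: "\<forall>s\<in>{0<..<s0}. g s < 0"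
    and g_pos: "\<forall>s>s0. g s > 0"
    and osgood: "\<forall>c>s0. filterlim (\<lambda>t. integral {c..t} (\<lambda>\<tau>. 1 / (h \<tau> + g \<tau>))) at_top at_top"
    and A: "continuous_on UNIV A" "\<forall>x. A x \<ge> 0" "\<forall>x. A x = a (norm x)"
    and B: "continuous_on UNIV B" "\<forall>x. B x \<ge> 0" "\<forall>x. B x = b (norm x)"
    and u0: "u0 \<ge> s0"
  shows "\<exists>u :: real \<Rightarrow> real.
    locally_uniform_limit {0..} (radial_iterate N a b h g u0) u \<and>
    (\<forall>r\<ge>0. u r > 0) \<and>
    C2_halfline u \<and>
    C2_space (\<lambda>x :: real ^ 'n. u (norm x)) \<and>
    (\<forall>x :: real ^ 'n. laplacian (\<lambda>y. u (norm y)) x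
        = a (norm x) * h (u (norm x)) + b (norm x) * g (u (norm x))) \<and>
    u 0 = u0 \<and>
    (\<forall>c0>0. 
       (\<exists>C1>u0. \<forall>r\<in>{0..c0}. u0 \<le> u r \<and> u r \<le> C1) \<and>
       (\<exists>C2>0. \<forall>r\<in>{0..c0}. 0 \<le> rderiv u r \<and> rderiv u r \<le> C2 * (r + 1))) \<and>
    (let m = (\<lambda>s. if g u0 = 0 then a s * h u0 else (a s + b s) * min (h u0) (g u0));
         P_lower = radial_integral N m;
         P_upper = radial_integral N (\<lambda>s. a s + b s)
     in (filterlim P_lower at_top at_top \<longrightarrow> filterlim u at_top at_top) \<and>
        ((\<exists>L. (P_upper \<longlongrightarrow> L) at_top) \<longrightarrow> (\<exists>L. (u \<longlongrightarrow> L) at_top)))"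
proof -
  have dim: "N = DIM(real ^ 'n)" and "N \<ge> 2" using N by simp_all
  interpret monotone_radial_problem N a b h g u0
  proof
    \<comment> \<open>Along a unit vector \<open>a r = A (r *\<^sub>R e)\<close> for
      \<open>r \<ge> 0\<close>, so the profiles inherit continuity and sign from \<open>A\<close>
      and \<open>B\<close>.\<close>
    obtain e :: "real ^ 'n" where e: "norm e = 1"
      using norm_Basis nonempty_Basis by blast
    have radial: "continuous_on {0..} c" if "continuous_on UNIV C" "\<forall>x. C x = c (norm x)"
      for C :: "real ^ 'n \<Rightarrow> real" and c
    proof (rule continuous_on_eq)
      show "continuous_on {0..} (\<lambda>r. C (r *\<^sub>R e))"
        by (rule continuous_on_compose2[OF that(1)]) (auto intro!: continuous_intros)
    qed (use that(2) e in auto)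
    have nonneg: "c s \<ge> 0" if "\<forall>x. C x \<ge> 0" "\<forall>x. C x = c (norm x)" "s \<ge> 0"
      for C :: "real ^ 'n \<Rightarrow> real" and c s
      using that(1,3) that(2)[rule_format, of "s *\<^sub>R e"] e by (metis abs_of_nonneg mult.right_neutral norm_scaleR)
    show "continuous_on {0..} a" "continuous_on {0..} b"
      using radial A B by blast+
    show "a s \<ge> 0" "b s \<ge> 0" if "s \<ge> 0" for s
      using nonneg A B that by blast+
    show h_cont': "continuous_on {u0..} h"
      using s0_pos u0 by (intro continuous_on_subset[OF h_cont]) auto
    show "mono_on {u0..} h"
      using s0_pos u0 by (intro mono_on_subset[OF h_mono]) auto
    show "h u0 > 0" "g u0 \<ge> 0" "N \<ge> 2"
      using h_pos g_pos g_s0 s0_pos u0 N by (auto simp: le_less)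
    show g_cont': "continuous_on {u0..} g"
      using s0_pos u0 by (intro continuous_on_subset[OF g_cont]) auto
    \<comment> \<open>Monotonicity is given on the open half-line beyond \<open>s0\<close>, while
      \<open>u0\<close> may equal \<open>s0\<close>; there \<open>g s0 = 0\<close> lies below all
      later values.\<close>
    show "mono_on {u0..} g"
    proof (rule mono_onI)
      fix x y assume "x \<in> {u0..}" "y \<in> {u0..}" "x \<le> y"
      with u0 show "g x \<le> g y"
        using mono_onD[OF g_mono, of x y] g_pos g_s0 by (cases "x = s0"; cases "y = s0") (auto simp: less_imp_le)
    qed
    have pos: "h s + g s > 0" if "s \<ge> u0" for s
      using that h_pos g_pos g_s0 s0_pos u0 by (cases "s = s0") (auto intro!: add_pos_pos)
    \<comment> \<open>The hypothesis covers lower limits strictly above \<open>s0\<close>. Starting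
      at \<open>u0 + 1\<close> and enlarging the interval only increases the integral, since the
      integrand is positive.\<close>
    show "filterlim (\<lambda>t. integral {u0..t} (\<lambda>\<tau>. 1 / (h \<tau> + g \<tau>))) at_top at_top"
    proof (rule filterlim_at_top_mono)
      show "filterlim (\<lambda>t. integral {u0 + 1..t} (\<lambda>\<tau>. 1 / (h \<tau> + g \<tau>))) at_top at_top"
        using osgood u0 by simp
      have int: "(\<lambda>\<tau>. 1 / (h \<tau> + g \<tau>)) integrable_on {c..t}" if "c \<ge> u0" for c t
        by (intro integrable_continuous_real continuous_intros continuous_on_subset[OF h_cont']
            continuous_on_subset[OF g_cont'])
             (use that pos order_trans in \<open>force simp: less_imp_neq[symmetric]\<close>)+
      show "\<forall>\<^sub>F t in at_top. integral {u0 + 1..t} (\<lambda>\<tau>. 1 / (h \<tau> + g \<tau>))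
          \<le> integral {u0..t} (\<lambda>\<tau>. 1 / (h \<tau> + g \<tau>))"
        by (intro always_eventually allI integral_subset_le int)
           (use pos in \<open>auto intro: less_imp_le\<close>)
    qed
  qed
  let ?m = "\<lambda>s. if g u0 = 0 then a s * h u0 else (a s + b s) * min (h u0) (g u0)"
  have u0_pos: "u0 > 0" using s0_pos u0 by simp
  \<comment> \<open>Unfolding \<open>solution_eq\<close> itself would loop, as
    \<open>solution\<close> recurs in the source. The pattern with \<open>norm\<close> is rewritten
    only once.\<close>
  have sol: "(\<lambda>x :: real ^ 'n. solution (norm x))
      = (\<lambda>x. u0 + radial_integral N (source solution) (norm x))"
    by (rule ext) (rule fun_cong[OF solution_eq])
  note radial = \<open>N \<ge> 2\<close> dim continuous_on_source_solution
  have C2: "C2_space (\<lambda>x :: real ^ 'n. solution (norm x))"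
    unfolding sol by (rule C2_space_radial_integral[OF radial])
  have lap: "laplacian (\<lambda>y. solution (norm y)) x
      = a (norm x) * h (solution (norm x)) + b (norm x) * g (solution (norm x))" for x :: "real ^ 'n"
    using laplacian_radial_integral[OF radial, of u0 x] unfolding sol[symmetric] source_def .
  have m: "filterlim solution at_top at_top" if "filterlim (radial_integral N ?m) at_top at_top"
  proof (rule solution_at_top[OF _ _ that])
    show "continuous_on {0..} ?m"
      by (cases "g u0 = 0") (auto intro!: continuous_intros a_cont b_cont)
    show "?m s \<le> source (\<lambda>_. u0) s" if "s \<ge> 0" for s
    proof -
      \<comment> \<open>These settle the case \<open>g u0 \<noteq> 0\<close>. If
        \<open>g u0 = 0\<close>, the term with \<open>b\<close> drops out of the source and equality
        holds.\<close>
      have "a s * min (h u0) (g u0) \<le> a s * h u0" "b s * min (h u0) (g u0) \<le> b s * g u0"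
        using a_nonneg[OF that] b_nonneg[OF that] by (auto intro: mult_left_mono)
      then show ?thesis by (auto simp: source_def distrib_right)
    qed
  qed
  have "solution r > 0" if "r \<ge> 0" for r
    using solution_ge[OF that] u0_pos by simp
  moreover have "C2_halfline solution"
    by (subst solution_eq) (rule C2_halfline_radial_integral[OF radial(1,3)])
  moreover have "solution 0 = u0"
    by (subst solution_eq) simp
  moreover have "\<exists>C1>u0. \<forall>r\<in>{0..c0}. u0 \<le> solution r \<and> solution r \<le> C1" for c0
    using solution_bound[of c0] solution_ge by auto
  ultimately show ?thesis
    using locally_uniform_limit_iterate C2 lap m rderiv_solution_bound solution_convergent
    unfolding Let_def by (intro exI[of _ solution] conjI) blast+
qed

end
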